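(* Let $q$ be a prime power and let $n$ be a positive integer with $3\mid n$. Let $C$ be a $q$-ary Singleton-optimal locally repairable code of length $n$, minimum distance $d=7$ and locality $r=2$ with disjoint repair groups. Then \[ n\le 3\left\lfloor\frac{q^2+q+3}{3}\right\rfloor. \]
   Context: Codes are linear: an $[n,k,d]_q$ code $C$ is a $k$-dimensional subspace of $\mathbb{F}_q^n$ ($k\ge 1$) with minimum Hamming distance $d$; $C^\perp$ is its dual code. $C$ is a locally repairable code (LRC) with locality $r$ if for every coordinate $i\in[n]=\{1,\dots,n\}$ there is a codeword $\bm h\in C^\perp$ with $i\in\mathrm{supp}(\bm h)$ and Hamming weight at most $r+1$. When $(r+1)\mid n$, $C$ has disjoint repair groups if there are $\ell=n/(r+1)$ codewords $\bm h_1,\dots,\bm h_\ell\in C^\perp$, each of Hamming weight exactly $r+1$, with pairwise disjoint supports (so the supports partition $[n]$). Convention on optimality: when $(r+1)\mid n$, an LRC is called Singleton-optimal if $n-k=\frac{n}{r+1}+d-2-\left\lfloor\frac{d-2}{r+1}\right\rfloor$. (For $d=7$, $r=2$ the usual Singleton-type bound $d\le n-k-\lceil k/r\rceil+2$ cannot be met with equality, and this equation is used instead.) Thus for $d=7$, $r=2$, $3\mid n$, Singleton-optimal means $n-k=n/3+4$. *)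

theory Defs
  imports "HOL-Analysis.Analysis"
begin

text \<open>
  Vectors in \<open>F\<^sub>q\<^sup>n\<close> are modelled by the type \<open>'a ^ 'n\<close>, where \<open>'a\<close> is a finite field and the
  finite index type \<open>'n\<close> is the coordinate set; thus \<open>q = CARD('a)\<close> and \<open>n = CARD('n)\<close>.
\<close>

definition supp :: "'a::zero ^ 'n \<Rightarrow> 'n set" where
  "supp x = {i. x $ i \<noteq> 0}"

definition hamming_weight :: "'a::zero ^ 'n \<Rightarrow> nat" where
  "hamming_weight x = card (supp x)"

definition hamming_dist :: "'a ^ 'n \<Rightarrow> 'a ^ 'n \<Rightarrow> nat" where
  "hamming_dist x y = card {i. x $ i \<noteq> y $ i}"

text \<open>Only meaningful for codes with at least two words, as the minimum of the empty set is
  unspecified.\<close>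

definition min_distance :: "('a ^ 'n) set \<Rightarrow> nat" where
  "min_distance C = Min {hamming_dist x y | x y. x \<in> C \<and> y \<in> C \<and> x \<noteq> y}"

definition dual_code :: "('a::field ^ 'n) set \<Rightarrow> ('a ^ 'n) set" where
  "dual_code C = {h. \<forall>c\<in>C. scalar_product h c = 0}"

text \<open>\<open>C\<close> is an \<open>[n, k, d]\<close> code over \<open>'a\<close>, with \<open>n = CARD('n)\<close>.\<close>

definition linear_code :: "('a::{field,finite} ^ 'n) set \<Rightarrow> nat \<Rightarrow> nat \<Rightarrow> bool" where
  "linear_code C k d \<longleftrightarrow> vec.subspace C \<and> vec.dim C = k \<and> 1 \<le> k \<and> min_distance C = d"

definition locally_repairable :: "('a::{field,finite} ^ 'n) set \<Rightarrow> nat \<Rightarrow> bool" where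
  "locally_repairable C r \<longleftrightarrow>
     (\<forall>i. \<exists>h\<in>dual_code C. i \<in> supp h \<and> hamming_weight h \<le> r + 1)"

definition disjoint_repair_groups :: "('a::{field,finite} ^ 'n) set \<Rightarrow> nat \<Rightarrow> bool" where
  "disjoint_repair_groups C r \<longleftrightarrow> (r + 1) dvd CARD('n) \<and>
     (\<exists>h :: nat \<Rightarrow> 'a ^ 'n.
        (\<forall>j < CARD('n) div (r + 1). h j \<in> dual_code C \<and> hamming_weight (h j) = r + 1) \<and>
        disjoint_family_on (\<lambda>j. supp (h j)) {..<CARD('n) div (r + 1)})"

text \<open>The equation is stated over the integers to avoid truncated subtraction; integer
  \<open>div\<close> is the floor of the quotient.\<close>

definition singleton_optimal_lrc ::
    "('a::{field,finite} ^ 'n) set \<Rightarrow> nat \<Rightarrow> nat \<Rightarrow> nat \<Rightarrow> bool" where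
  "singleton_optimal_lrc C k d r \<longleftrightarrow>
     linear_code C k d \<and> locally_repairable C r \<and> (r + 1) dvd CARD('n) \<and>
     int CARD('n) - int k =
       int CARD('n) div (int r + 1) + int d - 2 - (int d - 2) div (int r + 1)"

end

theory Submission
  imports Defs
begin

text \<open>
  Write \<open>l = n / 3\<close> for the number of repair groups and let \<open>D\<close> be the space of words orthogonal
  to the \<open>l\<close> repair checks. Every coordinate \<open>i\<close> gives a word \<open>w i\<close> of weight 2 in \<open>D\<close>, supported
  on the other two coordinates of the group of \<open>i\<close>. Modulo \<open>C\<close>, whose codimension in \<open>D\<close> is 4,
  the \<open>w i\<close> are points of the projective space of dimension 3 over the field. Fix a coordinate
  \<open>a\<close> and a second coordinate \<open>b\<close> in its group. Because \<open>d = 7\<close>, the lines that join the point \<open>w a\<close>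
  to the points \<open>w i\<close>, where \<open>i = b\<close> or \<open>i\<close> lies outside the group of \<open>a\<close>, are pairwise distinct,
  and at most \<open>q\<^sup>2 + q + 1\<close> lines pass through a point. This gives \<open>n - 2 \<le> q\<^sup>2 + q + 1\<close>.
\<close>

section \<open>Counting words and bounding weights\<close>

lemma card_subspace_eq:
  fixes C :: "('a::{field,finite} ^ 'n) set"
  assumes "vec.subspace C"
  shows "card C = CARD('a) ^ vec.dim C"
proof -
  obtain B where B: "finite B" "vec.independent B" "vec.span B = C" "card B = vec.dim C"
    using vec.basis_subspace_exists[OF assms] by metis
  let ?f = "\<lambda>u :: 'a ^ 'n \<Rightarrow> 'a. \<Sum>v\<in>B. u v *s v"
  have "inj_on ?f (B \<rightarrow>\<^sub>E UNIV)"
  proof (rule inj_onI)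
    fix u u' assume u: "u \<in> B \<rightarrow>\<^sub>E UNIV" "u' \<in> B \<rightarrow>\<^sub>E UNIV" and eq: "?f u = ?f u'"
    have "(\<Sum>v\<in>B. (u v - u' v) *s v) = 0"
      using eq by (simp add: vec.scale_left_diff_distrib sum_subtractf)
    then have "u v = u' v" if "v \<in> B" for v
      using vec.independentD[OF B(2,1) order_refl, of "\<lambda>v. u v - u' v"] that by simp
    with u show "u = u'"
      by (rule PiE_ext)
  qed
  moreover have "?f ` (B \<rightarrow>\<^sub>E UNIV) = C"
  proof -
    \<comment> \<open>The span lets the coefficient function be arbitrary off \<open>B\<close>;
      restricting it to \<open>B\<close> leaves the sum unchanged.\<close>
    have "?f u \<in> ?f ` (B \<rightarrow>\<^sub>E UNIV)" for u
      by (rule image_eqI[where x = "restrict u B"]) auto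
    then show ?thesis
      using vec.span_finite[OF B(1)] B(3) by auto
  qed
  ultimately have "card C = card (B \<rightarrow>\<^sub>E (UNIV :: 'a set))"
    using card_image by fastforce
  then show ?thesis
    by (simp add: card_funcsetE B)
qed

lemma hamming_weight_ge_min_distance:
  fixes C :: "('a::{field,finite} ^ 'n) set"
  assumes "vec.subspace C" "x \<in> C" "x \<noteq> 0"
  shows "min_distance C \<le> hamming_weight x"
proof -
  have "hamming_weight x = hamming_dist x 0"
    by (simp add: hamming_weight_def hamming_dist_def supp_def)
  moreover have "0 \<in> C"
    using assms(1) by (rule vec.subspace_0)
  ultimately have "hamming_weight x \<in> {hamming_dist x y | x y. x \<in> C \<and> y \<in> C \<and> x \<noteq> y}"
    using assms(2,3) by blast
  moreover have "finite {hamming_dist x y | x y. x \<in> C \<and> y \<in> C \<and> x \<noteq> y}"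
    by (rule finite_subset[of _ "(\<lambda>(x, y). hamming_dist x y) ` (C \<times> C)"]) auto
  ultimately show ?thesis
    unfolding min_distance_def by (intro Min_le)
qed

lemma scalar_product_disjoint_supp:
  assumes "supp x \<inter> supp y = {}"
  shows "scalar_product x y = 0"
proof -
  have "x $ i * y $ i = 0" for i
    using assms by (cases "x $ i = 0") (auto simp: supp_def)
  then show ?thesis
    by (simp add: scalar_product_def)
qed

text \<open>Choose a pivot coordinate in each support. By disjointness the check \<open>h j\<close>
  sees no pivot but its own, so it recovers the entry there from the entries at non-pivots. A word
  of the kernel is thus determined by its \<open>CARD('n) - l\<close> non-pivot entries.\<close>

lemma card_common_kernel_le:
  fixes h :: "nat \<Rightarrow> 'a::{field,finite} ^ 'n"
  assumes disj: "disjoint_family_on (\<lambda>j. supp (h j)) {..<l}"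
    and ne: "\<And>j. j < l \<Longrightarrow> supp (h j) \<noteq> {}"
  shows "card {x. \<forall>j<l. scalar_product (h j) x = 0} \<le> CARD('a) ^ (CARD('n) - l)"
proof -
  let ?D = "{x. \<forall>j<l. scalar_product (h j) x = 0}"
  obtain p where p: "\<And>j. j < l \<Longrightarrow> p j \<in> supp (h j)"
    using ne by (meson ex_in_conv)
  define P where "P = p ` {..<l}"
  have only: "j' = j" if "j < l" "j' < l" "p j' \<in> supp (h j)" for j j'
    using disj p[of j'] that unfolding disjoint_family_on_def by blast
  have "inj_on p {..<l}"
    using only p by (metis inj_onI lessThan_iff)
  then have cP: "card P = l"
    by (simp add: P_def card_image)
  have "inj_on (\<lambda>x. restrict (\<lambda>i. x $ i) (- P)) ?D"
  proof (rule inj_onI)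
    fix x y assume xy: "x \<in> ?D" "y \<in> ?D"
      and eq: "restrict (\<lambda>i. x $ i) (- P) = restrict (\<lambda>i. y $ i) (- P)"
    have off: "x $ i = y $ i" if "i \<notin> P" for i
      using fun_cong[OF eq, of i] that by simp
    have on: "x $ p j = y $ p j" if j: "j < l" for j
    proof -
      \<comment> \<open>Either \<open>i\<close> is not a pivot and the words agree there, or it is
        the pivot of another check and \<open>h j\<close> vanishes there.\<close>
      have "h j $ i * x $ i = h j $ i * y $ i" if "i \<noteq> p j" for i
        using off[of i] only[OF j] that by (auto simp: P_def supp_def)
      then have "(\<Sum>i\<in>UNIV - {p j}. h j $ i * x $ i) = (\<Sum>i\<in>UNIV - {p j}. h j $ i * y $ i)"
        by (intro sum.cong) auto
      moreover have "scalar_product (h j) x = scalar_product (h j) y"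
        using xy j by simp
      ultimately have "h j $ p j * x $ p j = h j $ p j * y $ p j"
        by (simp add: scalar_product_def sum.remove[of UNIV "p j"])
      then show ?thesis
        using p[OF j] by (simp add: supp_def)
    qed
    have "x $ i = y $ i" for i
    proof (cases "i \<in> P")
      case True
      then obtain j where "j < l" "i = p j"
        by (auto simp: P_def)
      with on show ?thesis
        by simp
    qed (rule off)
    then show "x = y"
      by (simp add: vec_eq_iff)
  qed
  moreover have "(\<lambda>x. restrict (\<lambda>i. x $ i) (- P)) ` ?D \<subseteq> (- P) \<rightarrow>\<^sub>E UNIV"
    by auto
  ultimately have "card ?D \<le> card ((- P) \<rightarrow>\<^sub>E (UNIV :: 'a set))"
    by (intro card_inj_on_le) (auto intro: finite_PiE)
  also have "\<dots> = CARD('a) ^ (CARD('n) - l)"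
    by (simp add: card_funcsetE Compl_eq_Diff_UNIV card_Diff_subset cP)
  finally show ?thesis .
qed

text \<open>Exchange the two remaining entries of \<open>h\<close> and negate one of them; the two
  products then cancel.\<close>

lemma orthogonal_word_of_weight_two:
  fixes h :: "'a::field ^ 'n"
  assumes "hamming_weight h = 3" "i \<in> supp h"
  shows "\<exists>w. supp w = supp h - {i} \<and> scalar_product h w = 0"
proof -
  have "card (supp h - {i}) = 2"
    using assms by (simp add: hamming_weight_def)
  then obtain a b where ab: "supp h - {i} = {a, b}" "a \<noteq> b"
    by (auto simp: card_2_iff)
  define w where "w = (\<chi> m. if m = a then h $ b else if m = b then - (h $ a) else 0)"
  have nz: "h $ a \<noteq> 0" "h $ b \<noteq> 0"
    using ab by (auto simp: supp_def)
  have "supp w = {a, b}"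
    using ab nz by (auto simp: supp_def w_def)
  moreover have "scalar_product h w = (\<Sum>m\<in>{a, b}. h $ m * w $ m)"
    unfolding scalar_product_def
    by (rule sum.mono_neutral_right) (auto simp: w_def)
  then have "scalar_product h w = 0"
    using ab(2) by (simp add: w_def mult.commute)
  ultimately show ?thesis
    using ab(1) by metis
qed

theorem theorem9:
  fixes C :: "('a::{field,finite} ^ 'n) set" and q n k :: nat
  assumes "CARD('a) = q"
    and "CARD('n) = n"
    and "3 dvd n"
    and "singleton_optimal_lrc C k 7 2"
    and "disjoint_repair_groups C 2"
  shows "n \<le> 3 * ((q\<^sup>2 + q + 3) div 3)"
proof -

  \<comment> \<open>Parameters of the code and the space \<open>D\<close>\<close>
  define l where "l = n div 3"
  have n: "n = 3 * l"
    using assms(3) by (simp add: l_def)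
  have sub: "vec.subspace C" and dim: "vec.dim C = k" and md: "min_distance C = 7"
    using assms(4) by (auto simp: singleton_optimal_lrc_def linear_code_def)
  \<comment> \<open>The 4 is 7 - 2 - 1, where 1 is the floor of 5/3.\<close>
  have "int n - int k = int n div 3 + 4"
    using assms(2,4) by (simp add: singleton_optimal_lrc_def)
  then have codim: "n - l = k + 4"
    using n by linarith
  have "0 < n"
    using assms(2) by (metis zero_less_card_finite)
  then have l0: "0 < l"
    using n by simp
  have "1 < q"
    using assms(1) card_mono[of UNIV "{0, 1 :: 'a}"] by simp
  obtain h :: "nat \<Rightarrow> 'a ^ 'n" where
    h: "\<And>j. j < l \<Longrightarrow> h j \<in> dual_code C" "\<And>j. j < l \<Longrightarrow> hamming_weight (h j) = 3"
    and disj: "disjoint_family_on (\<lambda>j. supp (h j)) {..<l}"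
    using assms(2,5) by (auto simp: disjoint_repair_groups_def l_def)
  define D where "D = {x. \<forall>j<l. scalar_product (h j) x = 0}"
  have card3: "card (supp (h j)) = 3" if "j < l" for j
    using h(2)[OF that] by (simp add: hamming_weight_def)
  have cardD: "card D \<le> q ^ (k + 4)"
    using card_common_kernel_le[OF disj] card3 assms(1,2) codim
    by (force simp: D_def)
  have CD: "C \<subseteq> D"
    using h(1) by (auto simp: D_def dual_code_def)
  have subD: "vec.subspace D"
    by (rule vec.subspaceI)
      (auto simp: D_def scalar_product_def algebra_simps sum.distrib simp flip: sum_distrib_left)

  \<comment> \<open>The words of weight two\<close>
  define U where "U = (\<Union>j<l. supp (h j))"
  have "\<exists>w. w \<in> D \<and> (\<exists>j<l. i \<in> supp (h j) \<and> supp w = supp (h j) - {i})" if i: "i \<in> U" for i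
  proof -
    obtain j where j: "j < l" "i \<in> supp (h j)"
      using i by (auto simp: U_def)
    obtain w where w: "supp w = supp (h j) - {i}" "scalar_product (h j) w = 0"
      using orthogonal_word_of_weight_two[OF h(2)] j by blast
    have "scalar_product (h j') w = 0" if "j' < l" for j'
    proof (cases "j' = j")
      case False
      then have "supp (h j') \<inter> supp w = {}"
        using disj j that w(1) by (auto simp: disjoint_family_on_def)
      then show ?thesis
        by (rule scalar_product_disjoint_supp)
    qed (use w in simp)
    then show ?thesis
      using j w(1) by (auto simp: D_def)
  qed
  then obtain w where wD: "\<And>i. i \<in> U \<Longrightarrow> w i \<in> D"
    and w: "\<And>i. i \<in> U \<Longrightarrow> \<exists>j<l. i \<in> supp (h j) \<and> supp (w i) = supp (h j) - {i}"
    by metis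
  have supp_w: "supp (w i) = supp (h j) - {i}" if "j < l" "i \<in> supp (h j)" for i j
  proof -
    have "i \<in> U"
      using that by (auto simp: U_def)
    then obtain j' where j': "j' < l" "i \<in> supp (h j')" "supp (w i) = supp (h j') - {i}"
      using w by blast
    then have "j' = j"
      using disj that unfolding disjoint_family_on_def by blast
    then show ?thesis
      using j' by simp
  qed
  have card_w: "card (supp (w i)) = 2" if "i \<in> U" for i
    using w[OF that] card3 by auto
  \<comment> \<open>The support of \<open>w i\<close> is nonempty, so it identifies the repair
    group; \<open>i\<close> is the one coordinate of the group missing from it.\<close>
  have w_inj: "i = i'" if i: "i \<in> U" "i' \<in> U" "supp (w i) = supp (w i')" for i i'
  proof -
    obtain j where j: "j < l" "i \<in> supp (h j)"
      using i(1) by (auto simp: U_def)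
    obtain j' where j': "j' < l" "i' \<in> supp (h j')"
      using i(2) by (auto simp: U_def)
    have eq: "supp (h j) - {i} = supp (h j') - {i'}"
      using supp_w[OF j] supp_w[OF j'] i(3) by simp
    have "supp (w i) \<noteq> {}"
      using card_w[OF i(1)] by auto
    then have "supp (h j) \<inter> supp (h j') \<noteq> {}"
      using supp_w[OF j] supp_w[OF j'] i(3) by auto
    then have "j = j'"
      using disj j(1) j'(1) by (auto simp: disjoint_family_on_def)
    then show ?thesis
      using eq j j' by blast
  qed

  \<comment> \<open>The lines through the point \<open>w a\<close>\<close>
  obtain a b where ab: "a \<in> supp (h 0)" "b \<in> supp (h 0)" "a \<noteq> b"
    using card3[OF l0] by (auto simp: card_3_iff)
  have abU: "a \<in> U" "b \<in> U"
    using ab l0 by (auto simp: U_def)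
  \<comment> \<open>The words of \<open>D\<close> supported on group 0 form a plane spanned by
    \<open>w a\<close> and \<open>w b\<close>, so the third coordinate of that group would repeat
    the line through \<open>w a\<close> and \<open>w b\<close>. Leaving out it and \<open>a\<close>
    gives the \<open>n - 2\<close> below.\<close>
  define I where "I = insert b (\<Union>j\<in>{1..<l}. supp (h j))"
  have IU: "I \<subseteq> U"
    using abU by (auto simp: I_def U_def)
  have b_notin: "b \<notin> supp (h j)" if "j \<in> {1..<l}" for j
  proof -
    have "supp (h 0) \<inter> supp (h j) = {}"
      using that by (intro disjoint_family_onD[OF disj]) auto
    then show ?thesis
      using ab(2) by blast
  qed
  have cardI: "card I = n - 2"
  proof -
    have "card (\<Union>j\<in>{1..<l}. supp (h j)) = (\<Sum>j\<in>{1..<l}. card (supp (h j)))"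
      using disj by (intro card_UN_disjoint) (auto simp: disjoint_family_on_def)
    also have "\<dots> = 3 * (l - 1)"
      using card3 by simp
    finally have "card (\<Union>j\<in>{1..<l}. supp (h j)) = 3 * (l - 1)" .
    moreover have "b \<notin> (\<Union>j\<in>{1..<l}. supp (h j))"
      using b_notin by blast
    ultimately show ?thesis
      using n l0 by (simp add: I_def)
  qed
  \<comment> \<open>Coordinate \<open>b\<close> separates \<open>w a\<close> from all
    \<open>w i\<close> with \<open>i\<close> in \<open>I\<close>; it will isolate the coefficient of
    \<open>w a\<close>.\<close>
  have wa_b: "w a $ b \<noteq> 0"
    using supp_w[OF l0 ab(1)] ab by (auto simp: supp_def)
  have w_b: "w i $ b = 0" if "i \<in> I" for i
  proof (cases "i = b")
    case True
    then show ?thesis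
      using supp_w[OF l0 ab(2)] by (auto simp: supp_def)
  next
    case False
    then obtain j where j: "j \<in> {1..<l}" "i \<in> supp (h j)"
      using \<open>i \<in> I\<close> by (auto simp: I_def)
    then show ?thesis
      using supp_w[of j i] b_notin[of j] by (auto simp: supp_def)
  qed

  \<comment> \<open>All scalar multiples of the \<open>w i\<close>, with the shared zero word
    inserted once so that the nonzero ones can be counted by pairs.\<close>
  define X where "X = insert 0 ((\<lambda>(c, i). c *s w i) ` ((UNIV - {0}) \<times> I))"
  have X_cases: "\<exists>c. \<exists>i\<in>I. x = c *s w i" if "x \<in> X" for x
  proof (cases "x = 0")
    case True
    then have "x = 0 *s w b" and "b \<in> I"
      by (simp_all add: I_def)
    then show ?thesis
      by blast
  next
    case False
    then show ?thesis
      using that by (auto simp: X_def)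
  qed
  have cardX: "card X = 1 + (q - 1) * (n - 2)"
  proof -
    have eqD: "c = c' \<and> i = i'"
      if c: "c \<noteq> 0" "c' \<noteq> 0" and i: "i \<in> I" "i' \<in> I" and eq: "c *s w i = c' *s w i'"
      for c c' i i'
    proof -
      have "supp (w i) = supp (c *s w i)" "supp (w i') = supp (c' *s w i')"
        using c by (auto simp: supp_def)
      then have "i = i'"
        using eq i IU by (intro w_inj) auto
      moreover obtain m where "m \<in> supp (w i)"
        using card_w[of i] i(1) IU by fastforce
      moreover have "c * w i $ m = c' * w i' $ m"
        using arg_cong[OF eq, of "\<lambda>v. v $ m"] by simp
      ultimately show "c = c' \<and> i = i'"
        by (simp add: supp_def)
    qed
    have "inj_on (\<lambda>(c, i). c *s w i) ((UNIV - {0}) \<times> I)"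
    proof (rule inj_onI)
      fix p p' assume "p \<in> (UNIV - {0}) \<times> I" "p' \<in> (UNIV - {0}) \<times> I"
        and "(\<lambda>(c, i). c *s w i) p = (\<lambda>(c, i). c *s w i) p'"
      then show "p = p'"
        using eqD[of "fst p" "fst p'" "snd p" "snd p'"]
        by (simp add: case_prod_beta mem_Times_iff prod_eq_iff)
    qed
    then have "card ((\<lambda>(c, i). c *s w i) ` ((UNIV - {0}) \<times> I)) = (q - 1) * (n - 2)"
      using assms(1) by (simp add: card_image card_cartesian_product cardI card_Diff_singleton)
    moreover have "c *s w i \<noteq> 0" if "c \<noteq> 0" "i \<in> I" for c i
      using card_w[of i] that IU by (auto simp: supp_def)
    then have "0 \<notin> (\<lambda>(c, i). c *s w i) ` ((UNIV - {0}) \<times> I)"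
      by fastforce
    ultimately show ?thesis
      by (simp add: X_def)
  qed

  \<comment> \<open>Distinctness of the lines modulo \<open>C\<close>\<close>
  let ?F = "\<lambda>(c, x, y). c *s w a + x + y"
  have eqD: "c = c' \<and> x = x' \<and> y = y'"
    if x: "x \<in> X" "x' \<in> X" and y: "y \<in> C" "y' \<in> C"
      and eq: "c *s w a + x + y = c' *s w a + x' + y'"
    for x x' y y' c c'
  proof -
    \<comment> \<open>The equation puts \<open>z\<close> into \<open>C\<close>, yet \<open>z\<close>
      combines three words of weight 2. Its weight is at most 6, below the minimum distance 7, so it
      is zero.\<close>
    define z where "z = (c - c') *s w a + (x - x')"
    have "z = y' - y"
      using eq by (simp add: z_def vec.scale_left_diff_distrib algebra_simps)
    then have "z \<in> C"
      using y sub by (simp add: vec.subspace_diff)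
    obtain e i where i: "i \<in> I" "x = e *s w i"
      using X_cases[OF x(1)] by blast
    obtain e' i' where i': "i' \<in> I" "x' = e' *s w i'"
      using X_cases[OF x(2)] by blast
    have "supp z \<subseteq> supp (w a) \<union> supp (w i) \<union> supp (w i')"
      by (auto simp: z_def i i' supp_def)
    then have "card (supp z) \<le> card (supp (w a) \<union> supp (w i) \<union> supp (w i'))"
      by (intro card_mono) auto
    also have "\<dots> \<le> card (supp (w a)) + card (supp (w i)) + card (supp (w i'))"
      by (meson add_le_mono1 card_Un_le order_trans)
    also have "\<dots> = 6"
      using card_w[of a] card_w[of i] card_w[of i'] abU i(1) i'(1) IU by (simp add: subset_iff)
    finally have "hamming_weight z < min_distance C"
      by (simp add: hamming_weight_def md)
    then have "z = 0"
      using hamming_weight_ge_min_distance[OF sub \<open>z \<in> C\<close>] by linarith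
    moreover have "z $ b = (c - c') * w a $ b"
      using i i' w_b by (simp add: z_def left_diff_distrib)
    ultimately have "c = c'"
      using wa_b by simp
    moreover from this have "x = x'"
      using \<open>z = 0\<close> by (simp add: z_def)
    ultimately show "c = c' \<and> x = x' \<and> y = y'"
      using eq by simp
  qed
  have "inj_on ?F (UNIV \<times> X \<times> C)"
  proof (rule inj_onI)
    fix p p' assume "p \<in> UNIV \<times> X \<times> C" "p' \<in> UNIV \<times> X \<times> C" and "?F p = ?F p'"
    then show "p = p'"
      using eqD[of "fst (snd p)" "fst (snd p')" "snd (snd p)" "snd (snd p')" "fst p" "fst p'"]
      by (simp add: case_prod_beta mem_Times_iff prod_eq_iff)
  qed
  moreover have "?F ` (UNIV \<times> X \<times> C) \<subseteq> D"
  proof clarify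
    fix c :: 'a and x y assume "x \<in> X" "y \<in> C"
    then have "x \<in> D" "y \<in> D"
      using X_cases[of x] wD IU CD by (auto intro!: vec.subspace_scale[OF subD])
    then show "c *s w a + x + y \<in> D"
      using wD abU by (intro vec.subspace_add[OF subD] vec.subspace_scale[OF subD]) auto
  qed
  ultimately have "card ((UNIV :: 'a set) \<times> X \<times> C) \<le> card D"
    by (intro card_inj_on_le) auto
  then have "q * ((1 + (q - 1) * (n - 2)) * q ^ k) \<le> q ^ (k + 4)"
    using cardD assms(1) card_subspace_eq[OF sub]
    by (simp add: card_cartesian_product cardX dim)
  \<comment> \<open>One factor \<open>q\<close> counts the multiples of \<open>w a\<close>, and
    \<open>q ^ k\<close> counts \<open>C\<close>; cancelling both leaves
    \<open>q ^ 3\<close>.\<close>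
  then have "(q * q ^ k) * (1 + (q - 1) * (n - 2)) \<le> (q * q ^ k) * q ^ 3"
    by (simp add: power_add algebra_simps eval_nat_numeral)
  then have "1 + (q - 1) * (n - 2) \<le> q ^ 3"
    using \<open>1 < q\<close> by (subst (asm) mult_le_cancel1) auto
  \<comment> \<open>Writing \<open>q\<close> as \<open>Suc t\<close> avoids truncated subtraction in
    the factorization of \<open>q ^ 3 - 1\<close> as \<open>q - 1\<close> times
    \<open>q\<^sup>2 + q + 1\<close>.\<close>
  moreover define t where "t = q - 1"
  then have t: "q = Suc t" "0 < t"
    using \<open>1 < q\<close> by simp_all
  ultimately have "t * (n - 2) \<le> t * (q\<^sup>2 + q + 1)"
    by (simp add: power2_eq_square power3_eq_cube algebra_simps)
  then have "n - 2 \<le> q\<^sup>2 + q + 1"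
    using t(2) by (subst (asm) mult_le_cancel1) auto
  then have "n \<le> q\<^sup>2 + q + 3"
    by simp
  \<comment> \<open>As \<open>n\<close> is a multiple of 3, the bound may be rounded down to
    one.\<close>
  then have "l \<le> (q\<^sup>2 + q + 3) div 3"
    using div_le_mono[of n "q\<^sup>2 + q + 3" 3] by (simp add: l_def)
  then show ?thesis
    using n by simp
qed

end
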